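(* Let $C_{132}(x,p,q,r)=\sum_{n\geq0}x^n g(n)$ and $L(x;v)=\sum_{n\geq1}L_n(v)x^n$, where $L_n(v)=\sum_{i=1}^n g(n|ii)v^{i-1}$. Then $$C_{132}(x,p,q,r)=1+\frac{1+r(q-p)x}{1-prx}L(x;1),$$ and $L(x;v)$ satisfies $$\left((1-prx)^2-\frac{pqvx(1+r(q-p)x)}{1-v}\right)L(x;v)=px(1-prx)-\frac{pqxv(1-prx)(1+(q-p)rxv)}{(1-prxv)(1-v)}L(xv;1).$$
   Context: A Stirling permutation of order $n$ is a permutation $\sigma=\sigma_1\cdots\sigma_{2n}$ of the multiset $\{1,1,2,2,\ldots,n,n\}$ such that, for each $i\in[n]$, every entry between the two occurrences of $i$ is greater than $i$; $\mathcal{Q}_n$ is the set of these ($\mathcal{Q}_0$ consists of the empty word). For $\sigma\in\mathcal{Q}_n$: $\mathrm{des}(\sigma)$, $\mathrm{asc}(\sigma)$, $\mathrm{plat}(\sigma)$ are the numbers of $i\in\{1,\dots,2n-1\}$ with $\sigma_i>\sigma_{i+1}$, $\sigma_i<\sigma_{i+1}$, $\sigma_i=\sigma_{i+1}$ respectively. $\mathcal{Q}_n(132)$ is the set of $\sigma\in\mathcal{Q}_n$ with no subsequence $\sigma_{i_1}\sigma_{i_2}\sigma_{i_3}$ ($i_1<i_2<i_3$) satisfying $\sigma_{i_1}<\sigma_{i_3}<\sigma_{i_2}$. $g(n)=\sum_{\sigma\in\mathcal{Q}_n(132)}p^{\mathrm{plat}(\sigma)}q^{\mathrm{des}(\sigma)}r^{\mathrm{asc}(\sigma)}$,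 and $g(n|ii)$ is the same sum restricted to those $\sigma\in\mathcal{Q}_n(132)$ whose first two letters are $i,i$. Identities are of formal power series in $x$ with coefficients rational in $p,q,r,v$. *)

theory Defs
  imports
    "HOL-Combinatorics.Multiset_Permutations"
    "HOL-Computational_Algebra.Formal_Power_Series"
begin

text \<open>
  Words are lists, so positions are 0-based, whereas letters and orders are as usual
  (letters range over \<open>{1..n}\<close>).
\<close>

definition stirling_perms :: "nat \<Rightarrow> nat list set" where
  "stirling_perms n =
     {\<sigma> \<in> permutations_of_multiset (mset_set {1..n} + mset_set {1..n}).
        \<forall>i\<in>{1..n}. \<forall>a b c. a < b \<and> b < c \<and> c < length \<sigma> \<and> \<sigma> ! a = i \<and> \<sigma> ! c = i
          \<longrightarrow> \<sigma> ! b > i}"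

definition des :: "nat list \<Rightarrow> nat" where
  "des \<sigma> = card {i. Suc i < length \<sigma> \<and> \<sigma> ! i > \<sigma> ! Suc i}"

definition asc :: "nat list \<Rightarrow> nat" where
  "asc \<sigma> = card {i. Suc i < length \<sigma> \<and> \<sigma> ! i < \<sigma> ! Suc i}"

definition plat :: "nat list \<Rightarrow> nat" where
  "plat \<sigma> = card {i. Suc i < length \<sigma> \<and> \<sigma> ! i = \<sigma> ! Suc i}"

definition avoids_132 :: "nat list \<Rightarrow> bool" where
  "avoids_132 \<sigma> \<longleftrightarrow>
     \<not> (\<exists>i1 i2 i3. i1 < i2 \<and> i2 < i3 \<and> i3 < length \<sigma> \<and> \<sigma> ! i1 < \<sigma> ! i3 \<and> \<sigma> ! i3 < \<sigma> ! i2)"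

definition stirling_perms_132 :: "nat \<Rightarrow> nat list set" where
  "stirling_perms_132 n = {\<sigma> \<in> stirling_perms n. avoids_132 \<sigma>}"

text \<open>
  The parameters \<open>p, q, r, v\<close> are elements of an arbitrary field; the formal
  setting is the instance where the field is the field of rational functions and
  \<open>p, q, r, v\<close> are its indeterminates. Then \<open>L_132 p q r 1\<close> is \<open>L(x;1)\<close>.
\<close>

definition weight :: "'a::field \<Rightarrow> 'a \<Rightarrow> 'a \<Rightarrow> nat list \<Rightarrow> 'a" where
  "weight p q r \<sigma> = p ^ plat \<sigma> * q ^ des \<sigma> * r ^ asc \<sigma>"

definition g :: "'a::field \<Rightarrow> 'a \<Rightarrow> 'a \<Rightarrow> nat \<Rightarrow> 'a" where
  "g p q r n = (\<Sum>\<sigma>\<in>stirling_perms_132 n. weight p q r \<sigma>)"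

definition g_start :: "'a::field \<Rightarrow> 'a \<Rightarrow> 'a \<Rightarrow> nat \<Rightarrow> nat \<Rightarrow> 'a" where
  "g_start p q r n i =
     (\<Sum>\<sigma>\<in>{\<sigma> \<in> stirling_perms_132 n. take 2 \<sigma> = [i, i]}. weight p q r \<sigma>)"

definition C_132 :: "'a::field \<Rightarrow> 'a \<Rightarrow> 'a \<Rightarrow> 'a fps" where
  "C_132 p q r = Abs_fps (g p q r)"

definition L_coeff :: "'a::field \<Rightarrow> 'a \<Rightarrow> 'a \<Rightarrow> 'a \<Rightarrow> nat \<Rightarrow> 'a" where
  "L_coeff p q r v n = (\<Sum>i=1..n. g_start p q r n i * v ^ (i - 1))"

definition L_132 :: "'a::field \<Rightarrow> 'a \<Rightarrow> 'a \<Rightarrow> 'a \<Rightarrow> 'a fps" where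
  "L_132 p q r v = Abs_fps (\<lambda>n. if n \<ge> 1 then L_coeff p q r v n else 0)"

end

theory Submission
  imports Defs
begin

text \<open>
  If a 132-avoiding Stirling permutation starts with \<open>i\<close>, its letters above \<open>i\<close> occur in
  weakly increasing order, so the second \<open>i\<close> is separated from the first one by a block
  \<open>(i+1)(i+1)(i+2)(i+2)\<dots>\<close>. Let \<open>D(x;v)\<close> mark every nonempty permutation by its first letter
  \<open>i\<close> with \<open>v\<^sup>i\<^sup>-\<^sup>1\<close>. Deleting the pair \<open>(i+1)(i+1)\<close> behind the first letter gives
  \<open>(1 - prx) D(x;v) = (1 + r(q-p)x) L(x;v)\<close>.

  Deleting a leading pair \<open>ii\<close> leaves a permutation that is empty, starts with a letter
  below \<open>i\<close>, or (after relabelling) starts with \<open>ii\<close> again, and all of these arise. Summing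
  the middle case over \<open>i\<close> is a geometric sum in \<open>v\<close>, whence
  \<open>(1-v)(1 - prx) L(x;v) = (1-v)px + pqvx (D(x;v) - D(vx;1))\<close>. The theorem follows by
  eliminating \<open>D\<close>.
\<close>

section \<open>Conditions on triples of positions, by recursion on the word\<close>

definition occurs_before :: "'a \<Rightarrow> 'a \<Rightarrow> 'a list \<Rightarrow> bool" where
  "occurs_before x y w \<longleftrightarrow> (\<exists>i j. i < j \<and> j < length w \<and> w ! i = x \<and> w ! j = y)"

lemma occurs_before_Nil [simp]: "\<not> occurs_before x y []"
  by (simp add: occurs_before_def)

lemma occurs_before_Cons [simp]:
  "occurs_before x y (a # w) \<longleftrightarrow> x = a \<and> y \<in> set w \<or> occurs_before x y w" (is "?L \<longleftrightarrow> ?R")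
proof
  assume ?L
  then obtain i j where "i < j" "j < length (a # w)" "(a # w) ! i = x" "(a # w) ! j = y"
    unfolding occurs_before_def by blast
  then show ?R unfolding occurs_before_def by (cases i; cases j) auto
next
  assume ?R
  then show ?L
  proof (elim disjE conjE)
    assume "x = a" "y \<in> set w"
    then obtain j where "j < length w" "w ! j = y" by (auto simp: in_set_conv_nth)
    then show ?L using \<open>x = a\<close>
      unfolding occurs_before_def by (intro exI[of _ 0] exI[of _ "Suc j"]) auto
  next
    assume "occurs_before x y w"
    then obtain i j where "i < j" "j < length w" "w ! i = x" "w ! j = y"
      unfolding occurs_before_def by blast
    then show ?L
      unfolding occurs_before_def by (intro exI[of _ "Suc i"] exI[of _ "Suc j"]) auto
  qed
qed

lemma occurs_before_imp_set: "occurs_before x y w \<Longrightarrow> x \<in> set w \<and> y \<in> set w"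
  by (induction w) auto

lemma occurs_before_map:
  "occurs_before y z (map f w) \<longleftrightarrow> (\<exists>y' z'. occurs_before y' z' w \<and> y = f y' \<and> z = f z')"
  by (induction w) auto

text \<open>The first position of a triple is either the head, which leaves an ordered pair in the
  tail, or the whole triple lies in the tail. Both the Stirling condition and 132-avoidance have
  this form, so index arguments are needed only here.\<close>

lemma all_nth_triple_Cons:
  "(\<forall>i j k. i < j \<and> j < k \<and> k < length (a # w) \<longrightarrow>
       P ((a # w) ! i) ((a # w) ! j) ((a # w) ! k)) \<longleftrightarrow>
     (\<forall>y z. occurs_before y z w \<longrightarrow> P a y z) \<and>
     (\<forall>i j k. i < j \<and> j < k \<and> k < length w \<longrightarrow> P (w ! i) (w ! j) (w ! k))" (is "?L \<longleftrightarrow> ?R1 \<and> ?R2")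
proof (intro iffI conjI allI impI; (elim conjE)?)
  fix y z assume ?L "occurs_before y z w"
  from this(2) obtain j k where "j < k" "k < length w" "w ! j = y" "w ! k = z"
    unfolding occurs_before_def by blast
  with \<open>?L\<close>[rule_format, of 0 "Suc j" "Suc k"] show "P a y z" by simp
next
  fix i j k assume ?L "i < j" "j < k" "k < length w"
  then show "P (w ! i) (w ! j) (w ! k)"
    using \<open>?L\<close>[rule_format, of "Suc i" "Suc j" "Suc k"] by simp
next
  fix i j k assume R: ?R1 ?R2 and ijk: "i < j" "j < k" "k < length (a # w)"
  obtain j' k' where jk: "j = Suc j'" "k = Suc k'" "j' < k'" "k' < length w"
    using ijk by (cases j; cases k) auto
  show "P ((a # w) ! i) ((a # w) ! j) ((a # w) ! k)"
  proof (cases i)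
    case 0
    have "occurs_before (w ! j') (w ! k') w" using jk unfolding occurs_before_def by blast
    then show ?thesis using R(1) jk 0 by simp
  next
    case (Suc i')
    then show ?thesis using R(2) jk ijk by simp
  qed
qed

text \<open>No alphabet is fixed, so the condition also makes sense for tails and relabelled words.
  Its implications are nested to match \<open>all_nth_triple_Cons\<close>.\<close>

definition stirling_word :: "nat list \<Rightarrow> bool" where
  "stirling_word w \<longleftrightarrow>
     (\<forall>a b c. a < b \<and> b < c \<and> c < length w \<longrightarrow> w ! a = w ! c \<longrightarrow> w ! a < w ! b)"

lemma stirling_word_Cons:
  "stirling_word (a # w) \<longleftrightarrow> (\<forall>y. occurs_before y a w \<longrightarrow> a < y) \<and> stirling_word w"
  unfolding stirling_word_def
    all_nth_triple_Cons[where P = "\<lambda>x y z. x = z \<longrightarrow> x < y"] by blast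

lemma avoids_132_alt:
  "avoids_132 w \<longleftrightarrow>
     (\<forall>a b c. a < b \<and> b < c \<and> c < length w \<longrightarrow> w ! a < w ! c \<longrightarrow> w ! b \<le> w ! c)"
  unfolding avoids_132_def not_le[symmetric] by blast

lemma avoids_132_Cons:
  "avoids_132 (a # w) \<longleftrightarrow>
     (\<forall>y z. occurs_before y z w \<longrightarrow> a < z \<longrightarrow> y \<le> z) \<and> avoids_132 w"
  unfolding avoids_132_alt
    all_nth_triple_Cons[where P = "\<lambda>x y z. x < z \<longrightarrow> y \<le> z"] by blast

lemma stirling_word_map:
  assumes "strict_mono f"
  shows "stirling_word (map f w) \<longleftrightarrow> stirling_word w"
proof -
  have "(a < b \<and> b < c \<and> c < length (map f w) \<longrightarrow> map f w ! a = map f w ! c \<longrightarrow>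
           map f w ! a < map f w ! b) \<longleftrightarrow>
        (a < b \<and> b < c \<and> c < length w \<longrightarrow> w ! a = w ! c \<longrightarrow> w ! a < w ! b)" for a b c
    using assms by (auto simp: strict_mono_less strict_mono_eq)
  then show ?thesis unfolding stirling_word_def by simp
qed

lemma avoids_132_map:
  assumes "strict_mono f"
  shows "avoids_132 (map f w) \<longleftrightarrow> avoids_132 w"
proof -
  have "(i1 < i2 \<and> i2 < i3 \<and> i3 < length (map f w) \<and>
           map f w ! i1 < map f w ! i3 \<and> map f w ! i3 < map f w ! i2) \<longleftrightarrow>
        (i1 < i2 \<and> i2 < i3 \<and> i3 < length w \<and> w ! i1 < w ! i3 \<and> w ! i3 < w ! i2)" for i1 i2 i3
    using assms by (auto simp: strict_mono_less)
  then show ?thesis unfolding avoids_132_def by simp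
qed

section \<open>The weight, letter by letter\<close>

lemma weight_map:
  assumes "strict_mono f"
  shows "weight p q r (map f w) = weight p q r w"
proof -
  have *: "(Suc i < length (map f w) \<and> R (map f w ! i) (map f w ! Suc i)) \<longleftrightarrow>
      (Suc i < length w \<and> R (w ! i) (w ! Suc i))"
    if "\<And>x y. R (f x) (f y) \<longleftrightarrow> R x y" for i and R :: "nat \<Rightarrow> nat \<Rightarrow> bool"
    using that by auto
  show ?thesis
    unfolding weight_def plat_def des_def asc_def
    using *[of "(<)"] *[of "(=)"] *[of "(>)"] assms
    by (simp add: strict_mono_less strict_mono_eq)
qed

text \<open>Position 0 compares \<open>a\<close> with \<open>b\<close>, and every other position is
  shifted by one. With \<open>R\<close> left arbitrary, one argument serves plateaus, descents and
  ascents.\<close>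

lemma card_adjacent_Cons_Cons:
  "card {i. Suc i < length (a # b # w) \<and> R ((a # b # w) ! i) ((a # b # w) ! Suc i)} =
     (if R a b then 1 else 0) +
     card {i. Suc i < length (b # w) \<and> R ((b # w) ! i) ((b # w) ! Suc i)}"
  (is "card ?A = _ + card ?B")
proof -
  have "?A = (if R a b then {0} else {}) \<union> Suc ` ?B"
  proof (rule set_eqI)
    show "i \<in> ?A \<longleftrightarrow> i \<in> (if R a b then {0} else {}) \<union> Suc ` ?B" for i
      by (cases i) auto
  qed
  moreover have "finite ?B" by (rule finite_subset[of _ "{..<length (b # w)}"]) auto
  ultimately show ?thesis by (simp add: card_image card_Un_disjoint)
qed

lemma weight_Nil [simp]: "weight p q r [] = 1"
  by (simp add: weight_def plat_def des_def asc_def)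

lemma weight_singleton [simp]: "weight p q r [a] = 1"
  by (simp add: weight_def plat_def des_def asc_def)

lemma weight_Cons_Cons:
  "weight p q r (a # b # w) =
     (if a = b then p else if b < a then q else r) * weight p q r (b # w)"
  using card_adjacent_Cons_Cons[of a b w "(=)"] card_adjacent_Cons_Cons[of a b w "(>)"]
    card_adjacent_Cons_Cons[of a b w "(<)"]
  by (auto simp: weight_def plat_def des_def asc_def)

section \<open>Relabelling that makes room for a new letter \<open>a\<close>\<close>

definition skip :: "nat \<Rightarrow> nat \<Rightarrow> nat" where
  "skip a x = (if x < a then x else Suc x)"

definition unskip :: "nat \<Rightarrow> nat \<Rightarrow> nat" where
  "unskip a x = (if x < a then x else x - 1)"

lemma strict_mono_skip: "strict_mono (skip a)"
  by (auto simp: strict_mono_def skip_def)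

lemma inj_skip: "inj (skip a)"
  using strict_mono_skip by (rule strict_mono_imp_inj_on)

lemma skip_neq [simp]: "skip a x \<noteq> a" "a \<noteq> skip a x"
  by (auto simp: skip_def)

lemma unskip_skip [simp]: "unskip a (skip a x) = x"
  by (simp add: skip_def unskip_def)

lemma skip_unskip: "x \<noteq> a \<Longrightarrow> skip a (unskip a x) = x"
  by (auto simp: skip_def unskip_def)

lemma skip_image_atLeastAtMost:
  assumes "1 \<le> a" "a \<le> Suc n"
  shows "insert a (skip a ` {1..n}) = {1..Suc n}"
proof (intro equalityI subsetI)
  fix x assume "x \<in> {1..Suc n}"
  then show "x \<in> insert a (skip a ` {1..n})"
    using assms by (cases "x = a") (auto intro!: image_eqI[of _ _ "unskip a x"]
      simp: skip_unskip, auto simp: unskip_def)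
qed (use assms in \<open>auto simp: skip_def\<close>)

definition doubled :: "nat \<Rightarrow> nat multiset" where
  "doubled n = mset_set {1..n} + mset_set {1..n}"

lemma set_mset_doubled [simp]: "set_mset (doubled n) = {1..n}"
  by (simp add: doubled_def)

lemma count_doubled: "i \<in> {1..n} \<Longrightarrow> count (doubled n) i = 2"
  by (simp add: doubled_def)

lemma doubled_Suc:
  assumes "1 \<le> a" "a \<le> Suc n"
  shows "doubled (Suc n) = {#a, a#} + image_mset (skip a) (doubled n)"
proof -
  have "mset_set {1..Suc n} = add_mset a (mset_set (skip a ` {1..n}))"
    using skip_image_atLeastAtMost[OF assms] by (metis (no_types, lifting) finite_atLeastAtMost
      finite_imageI imageE mset_set.insert skip_neq(2))
  also have "mset_set (skip a ` {1..n}) = image_mset (skip a) (mset_set {1..n})"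
    by (metis image_mset_mset_set inj_on_subset inj_skip subset_UNIV)
  finally show ?thesis by (simp add: doubled_def)
qed

text \<open>All letters lie in \<open>{1..n}\<close>, so quantifying over the repeated letter
  amounts to quantifying over positions that carry equal letters.\<close>

lemma stirling_perms_132_iff:
  "w \<in> stirling_perms_132 n \<longleftrightarrow> mset w = doubled n \<and> stirling_word w \<and> avoids_132 w"
proof -
  have "(\<forall>i\<in>{1..n}. \<forall>a b c. a < b \<and> b < c \<and> c < length w \<and> w ! a = i \<and> w ! c = i
          \<longrightarrow> w ! b > i) \<longleftrightarrow> stirling_word w" (is "?L \<longleftrightarrow> _") if "mset w = doubled n"
  proof
    have set: "set w = {1..n}" using that by (metis set_mset_doubled set_mset_mset)
    assume ?L
    show "stirling_word w" unfolding stirling_word_def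
    proof (intro allI impI, elim conjE)
      fix a b c assume abc: "a < b" "b < c" "c < length w" "w ! a = w ! c"
      then have "w ! a \<in> {1..n}" by (metis set nth_mem)
      then show "w ! a < w ! b"
        by (rule \<open>?L\<close>[rule_format, of "w ! a" a b c]) (intro conjI abc refl abc(4)[symmetric])
    qed
  next
    assume st: "stirling_word w"
    show ?L
    proof (intro ballI allI impI, elim conjE)
      fix i a b c assume "a < b" "b < c" "c < length w" "w ! a = i" "w ! c = i"
      then show "i < w ! b" using st[unfolded stirling_word_def, rule_format, of a b c] by metis
    qed
  qed
  then show ?thesis
    unfolding stirling_perms_132_def stirling_perms_def permutations_of_multiset_def
      mem_Collect_eq doubled_def[symmetric] by blast
qed

lemma finite_stirling_perms_132: "finite (stirling_perms_132 n)"
  by (simp add: stirling_perms_132_def stirling_perms_def)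

lemma set_stirling_perms_132:
  "w \<in> stirling_perms_132 n \<Longrightarrow> set w = {1..n}"
  by (metis set_mset_doubled set_mset_mset stirling_perms_132_iff)

lemma stirling_perms_132_0: "stirling_perms_132 0 = {[]}"
  by (auto simp: stirling_perms_132_iff doubled_def stirling_word_def avoids_132_def)

section \<open>Building order \<open>Suc n\<close> from order \<open>n\<close> by inserting an
  adjacent pair\<close>

lemma mset_Cons_eq_doubled_imp_mem:
  assumes "mset (i # w) = doubled n" shows "i \<in> set w"
proof -
  have "i \<in> {1..n}" using assms by (metis list.set_intros(1) set_mset_doubled set_mset_mset)
  then have "count (mset (i # w)) i = 2" using assms count_doubled by metis
  then show ?thesis by (metis One_nat_def Suc_1 count_mset_0_iff add_mset_add_single count_add_mset
    mset.simps(2) nat.inject zero_neq_one)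
qed

text \<open>The two copies of \<open>a\<close> use up its multiplicity, so the remaining letters
  avoid \<open>a\<close> and \<open>unskip a\<close> closes the gap.\<close>

lemma mset_pair_eq_doubled_iff:
  assumes "1 \<le> a" "a \<le> Suc n"
  shows "{#a, a#} + mset w = doubled (Suc n) \<longleftrightarrow>
           (\<exists>u. w = map (skip a) u \<and> mset u = doubled n)"
proof
  assume "{#a, a#} + mset w = doubled (Suc n)"
  then have w: "mset w = image_mset (skip a) (doubled n)"
    by (simp add: doubled_Suc[OF assms])
  then have "set w = skip a ` {1..n}"
    by (metis set_image_mset set_mset_doubled set_mset_mset)
  then have "w = map (skip a) (map (unskip a) w)"
    unfolding map_map by (intro map_idI[symmetric]) auto
  moreover have "mset (map (unskip a) w) = doubled n"
    by (simp add: w multiset.map_comp o_def)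
  ultimately show "\<exists>u. w = map (skip a) u \<and> mset u = doubled n" by blast
next
  assume "\<exists>u. w = map (skip a) u \<and> mset u = doubled n"
  then show "{#a, a#} + mset w = doubled (Suc n)"
    by (auto simp: doubled_Suc[OF assms])
qed

text \<open>The copies of \<open>i\<close> are adjacent and \<open>i\<close> does not recur, so the
  Stirling condition gains nothing. A new 132 pattern can only use a leading \<open>i\<close> as its
  smallest letter, hence the letters above \<open>i\<close> must increase weakly.\<close>

lemma prepend_pair_in_stirling_perms_132_iff:
  assumes "1 \<le> i" "i \<le> Suc n"
  shows "i # i # map (skip i) u \<in> stirling_perms_132 (Suc n) \<longleftrightarrow>
           u \<in> stirling_perms_132 n \<and> (\<forall>y z. occurs_before y z u \<longrightarrow> i \<le> z \<longrightarrow> y \<le> z)"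
proof -
  have i: "i \<notin> set (map (skip i) u)" by auto
  have "mset (i # i # map (skip i) u) = doubled (Suc n) \<longleftrightarrow> mset u = doubled n"
    using mset_pair_eq_doubled_iff[OF assms, of "map (skip i) u"] inj_skip[of i]
    by (auto simp: inj_map_eq_map)
  moreover have "stirling_word (i # i # map (skip i) u) \<longleftrightarrow> stirling_word u"
    using i by (auto simp: stirling_word_Cons stirling_word_map[OF strict_mono_skip]
      dest: occurs_before_imp_set)
  moreover have "(\<forall>y z. occurs_before y z (map (skip i) u) \<longrightarrow> i < z \<longrightarrow> y \<le> z) \<longleftrightarrow>
      (\<forall>y z. occurs_before y z u \<longrightarrow> i \<le> z \<longrightarrow> y \<le> z)"
  proof -
    \<comment> \<open>The letters of \<open>u\<close> from \<open>i\<close> on are raised, so the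
      strict bound turns into a weak one.\<close>
    have "i < skip i z \<longleftrightarrow> i \<le> z" "skip i y \<le> skip i z \<longleftrightarrow> y \<le> z" for y z
      by (auto simp: skip_def)
    then show ?thesis unfolding occurs_before_map by blast
  qed
  then have "avoids_132 (i # i # map (skip i) u) \<longleftrightarrow>
      avoids_132 u \<and> (\<forall>y z. occurs_before y z u \<longrightarrow> i \<le> z \<longrightarrow> y \<le> z)"
    by (auto simp: avoids_132_Cons avoids_132_map[OF strict_mono_skip])
  ultimately show ?thesis unfolding stirling_perms_132_iff by blast
qed

text \<open>A first letter below \<open>i\<close> enforces the order through 132-avoidance. If the
  first letter is at least \<open>i\<close>, testing the order at \<open>z = i\<close> forces both
  copies of \<open>i\<close> to the front.\<close>

lemma stirling_perms_132_tail_sorted_iff: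
  assumes "u \<in> stirling_perms_132 n" "1 \<le> i"
  shows "(\<forall>y z. occurs_before y z u \<longrightarrow> i \<le> z \<longrightarrow> y \<le> z) \<longleftrightarrow>
           u = [] \<or> u \<noteq> [] \<and> hd u < i \<or> take 2 u = [i, i]" (is "?L \<longleftrightarrow> ?R")
proof
  assume L: ?L
  show ?R
  proof (cases u)
    case (Cons f w)
    show ?thesis
    proof (cases "f < i")
      case False
      have "set u = {1..n}" using assms set_stirling_perms_132 by blast
      moreover from this have "f \<in> {1..n}" using Cons by auto
      ultimately have "i \<in> set u" using False assms(2) by auto
      \<comment> \<open>Otherwise \<open>f\<close> exceeds \<open>i\<close> and precedes a copy of
        \<open>i\<close>.\<close>
      have "f = i"
      proof (rule ccontr)
        assume "f \<noteq> i"
        then have "occurs_before f i u" using Cons \<open>i \<in> set u\<close> by auto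
        then show False using L False \<open>f \<noteq> i\<close> by force
      qed
      have st: "mset (i # w) = doubled n" "stirling_word (i # w)"
        using assms(1) Cons \<open>f = i\<close> by (auto simp: stirling_perms_132_iff)
      have "i \<in> set w" using st(1) by (rule mset_Cons_eq_doubled_imp_mem)
      then obtain y ws where w: "w = y # ws" by (cases w) auto
      \<comment> \<open>Otherwise \<open>y\<close> stands between the two copies of
        \<open>i\<close>; it is then larger than \<open>i\<close> and precedes the second
        copy.\<close>
      have "y = i"
      proof (rule ccontr)
        assume "y \<noteq> i"
        then have "occurs_before y i w" using w \<open>i \<in> set w\<close> by auto
        moreover from this have "i < y" using st(2) by (auto simp: stirling_word_Cons)
        ultimately show False using L Cons by force
      qed
      then show ?thesis using Cons w \<open>f = i\<close> by (simp add: numeral_2_eq_2)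
    qed (use Cons in simp)
  qed simp
next
  assume ?R
  then consider "u = []" | f w where "u = f # w" "f < i" | w where "u = i # i # w"
    by (cases u rule: list.exhaust; cases "tl u") (auto simp: numeral_2_eq_2)
  then show ?L
  proof cases
    case 2
    then show ?thesis using assms(1) by (force simp: stirling_perms_132_iff avoids_132_Cons)
  next
    case 3
    have mset: "mset (i # i # w) = doubled n" and av: "avoids_132 (i # i # w)"
      using assms(1) 3 by (auto simp: stirling_perms_132_iff)
    have "i \<in> {1..n}" using mset by (metis list.set_intros(1) set_mset_doubled set_mset_mset)
    \<comment> \<open>Past the leading pair no \<open>i\<close> is left, so there
      \<open>i \<le> z\<close> means \<open>i < z\<close>, the range that avoidance with smallest
      letter \<open>i\<close> controls.\<close>
    then have "count (mset w) i = 0" using count_doubled[of i n] mset[symmetric] by simp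
    then have "i \<notin> set w" by (simp add: count_mset_0_iff)
    show ?thesis
    proof (intro allI impI)
      fix y z assume yz: "occurs_before y z u" "i \<le> z"
      show "y \<le> z"
      proof (cases "occurs_before y z w")
        case True
        then have "z \<noteq> i" using \<open>i \<notin> set w\<close> occurs_before_imp_set by metis
        then show ?thesis using True av yz by (auto simp: avoids_132_Cons)
      qed (use yz 3 in auto)
    qed
  qed simp
qed

lemma stirling_perms_132_start_pair:
  assumes "1 \<le> i" "i \<le> Suc n"
  shows "{w \<in> stirling_perms_132 (Suc n). take 2 w = [i, i]} =
    (\<lambda>u. i # i # map (skip i) u) `
      {u \<in> stirling_perms_132 n. u = [] \<or> u \<noteq> [] \<and> hd u < i \<or> take 2 u = [i, i]}"
    (is "?A = ?f ` ?B")
proof (intro equalityI subsetI)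
  fix w assume w: "w \<in> ?A"
  then obtain w' where w': "w = i # i # w'"
    by (cases w; cases "tl w") (auto simp: numeral_2_eq_2)
  have "{#i, i#} + mset w' = doubled (Suc n)"
    using w w' by (simp add: stirling_perms_132_iff)
  then obtain u where u: "w' = map (skip i) u"
    unfolding mset_pair_eq_doubled_iff[OF assms] by blast
  have "u \<in> ?B"
    using w prepend_pair_in_stirling_perms_132_iff[OF assms, of u]
      stirling_perms_132_tail_sorted_iff[OF _ assms(1), of u n] unfolding w' u by blast
  then show "w \<in> ?f ` ?B" using w' u by blast
next
  fix w assume "w \<in> ?f ` ?B"
  then obtain u where "u \<in> ?B" "w = ?f u" by blast
  then show "w \<in> ?A"
    using prepend_pair_in_stirling_perms_132_iff[OF assms, of u]
      stirling_perms_132_tail_sorted_iff[OF _ assms(1), of u n] by auto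
qed

text \<open>The inserted copies of \<open>Suc i\<close> are adjacent and the only ones. In a 132
  pattern, \<open>Suc i\<close> cannot be the largest letter, since only \<open>i\<close> precedes
  it and no letter lies strictly between; nor the middle one, since nothing larger precedes it; as
  the smallest it may be replaced by the leading \<open>i\<close>.\<close>

lemma insert_pair_in_stirling_perms_132_iff:
  assumes "1 \<le> i" "i \<le> n"
  shows "i # Suc i # Suc i # map (skip (Suc i)) u \<in> stirling_perms_132 (Suc n) \<longleftrightarrow>
           i # u \<in> stirling_perms_132 n"
proof -
  define v where "v = map (skip (Suc i)) u"
  have skip_v: "map (skip (Suc i)) (i # u) = i # v" by (simp add: v_def skip_def)
  have "Suc i \<notin> set v" by (auto simp: v_def)
  have "mset (i # Suc i # Suc i # v) = {#Suc i, Suc i#} + mset (map (skip (Suc i)) (i # u))"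
    unfolding skip_v by simp
  then have "mset (i # Suc i # Suc i # v) = doubled (Suc n) \<longleftrightarrow> mset (i # u) = doubled n"
    using mset_pair_eq_doubled_iff[of "Suc i" n "map (skip (Suc i)) (i # u)"]
      assms inj_skip[of "Suc i"] by (auto simp: inj_map_eq_map simp del: list.map mset.simps)
  moreover have "stirling_word (i # Suc i # Suc i # v) \<longleftrightarrow> stirling_word (i # v)"
  proof -
    have "\<not> occurs_before y (Suc i) v" for y
      using \<open>Suc i \<notin> set v\<close> occurs_before_imp_set by metis
    then show ?thesis using \<open>Suc i \<notin> set v\<close> by (auto simp: stirling_word_Cons)
  qed
  then have "stirling_word (i # Suc i # Suc i # v) \<longleftrightarrow> stirling_word (i # u)"
    by (metis skip_v stirling_word_map strict_mono_skip)
  moreover have "avoids_132 (i # Suc i # Suc i # v) \<longleftrightarrow> avoids_132 (i # v)"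
  proof
    assume "avoids_132 (i # v)"
    then have av: "avoids_132 v" "\<And>y z. occurs_before y z v \<Longrightarrow> i < z \<Longrightarrow> y \<le> z"
      unfolding avoids_132_Cons by blast+
    show "avoids_132 (i # Suc i # Suc i # v)"
      unfolding avoids_132_Cons occurs_before_Cons
      using av by force
  next
    assume "avoids_132 (i # Suc i # Suc i # v)"
    then show "avoids_132 (i # v)"
      unfolding avoids_132_Cons occurs_before_Cons by blast
  qed
  then have "avoids_132 (i # Suc i # Suc i # v) \<longleftrightarrow> avoids_132 (i # u)"
    by (metis skip_v avoids_132_map strict_mono_skip)
  ultimately show ?thesis unfolding stirling_perms_132_iff v_def by blast
qed

text \<open>The second letter lies between the two copies of \<open>i\<close>, hence exceeds
  \<open>i\<close>. Since the letters above \<open>i\<close> increase weakly, it is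
  \<open>Suc i\<close>; the Stirling condition for \<open>Suc i\<close> then brings its other copy
  next to it.\<close>

lemma stirling_perms_132_start_no_pair:
  assumes "1 \<le> i"
  shows "{w \<in> stirling_perms_132 (Suc n). take 1 w = [i] \<and> take 2 w \<noteq> [i, i]} =
    (\<lambda>u. i # Suc i # Suc i # map (skip (Suc i)) (tl u)) `
      {u \<in> stirling_perms_132 n. take 1 u = [i]}" (is "?A = ?f ` ?B")
proof (intro equalityI subsetI)
  fix w assume w: "w \<in> ?A"
  then obtain w1 where w1: "w = i # w1" by (cases w) auto
  have set: "set w = {1..Suc n}" using w set_stirling_perms_132 by blast
  have perm: "mset w = doubled (Suc n)" "stirling_word w" "avoids_132 w"
    using w by (auto simp: stirling_perms_132_iff)
  have "i \<in> set w1" using perm(1) unfolding w1 by (rule mset_Cons_eq_doubled_imp_mem)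
  then obtain y w2 where w2: "w1 = y # w2" by (cases w1) auto
  have "y \<noteq> i" using w w1 w2 by (auto simp: numeral_2_eq_2)
  then have "occurs_before y i w1" using \<open>i \<in> set w1\<close> w2 by auto
  then have "i < y" using perm(2) w1 by (auto simp: stirling_word_Cons)
  moreover have "y \<in> {1..Suc n}" using set w1 w2 by auto
  ultimately have "i \<le> n" by auto
  then have "Suc i \<in> set w1" using set w1 by force
  have sorted: "y' \<le> z" if "occurs_before y' z w1" "i < z" for y' z
    using that perm(3) w1 by (auto simp: avoids_132_Cons)
  have "y = Suc i"
    using sorted[of y "Suc i"] \<open>Suc i \<in> set w1\<close> \<open>i < y\<close> w2 by force
  \<comment> \<open>Swapping the first two letters puts \<open>Suc i\<close> at the head, so that
    the multiplicity argument yields its second copy.\<close>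
  have "mset (Suc i # i # w2) = doubled (Suc n)" using perm(1) w1 w2 \<open>y = Suc i\<close>
    by (simp add: add_mset_commute)
  then have "Suc i \<in> set w2" using mset_Cons_eq_doubled_imp_mem by fastforce
  then obtain z w3 where w3: "w2 = z # w3" by (cases w2) auto
  have "z = Suc i"
  proof (rule ccontr)
    assume "z \<noteq> Suc i"
    then have "occurs_before z (Suc i) w2" using \<open>Suc i \<in> set w2\<close> w3 by auto
    moreover from this have "Suc i < z"
      using perm(2) w1 w2 \<open>y = Suc i\<close> by (auto simp: stirling_word_Cons)
    ultimately show False using sorted[of z "Suc i"] w2 by auto
  qed
  have "{#Suc i, Suc i#} + mset (i # w3) = doubled (Suc n)"
    using perm(1) w1 w2 w3 \<open>y = Suc i\<close> \<open>z = Suc i\<close> by simp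
  then obtain u where u: "i # w3 = map (skip (Suc i)) u"
    using mset_pair_eq_doubled_iff[of "Suc i" n "i # w3"] \<open>i \<le> n\<close>
    by (metis Suc_le_mono le_add1 plus_1_eq_Suc)
  then obtain x u' where u': "u = x # u'" by (cases u) auto
  have "x = i" using u u' by (auto simp: skip_def split: if_splits)
  have "w = ?f u" "w = i # Suc i # Suc i # map (skip (Suc i)) u'"
    using w1 w2 w3 u u' \<open>y = Suc i\<close> \<open>z = Suc i\<close> by simp_all
  moreover from this have "u \<in> ?B"
    using w insert_pair_in_stirling_perms_132_iff[OF assms \<open>i \<le> n\<close>, of u'] u' \<open>x = i\<close> by auto
  ultimately show "w \<in> ?f ` ?B" by blast
next
  fix w assume "w \<in> ?f ` ?B"
  then obtain u where u: "u \<in> ?B" "w = ?f u" by blast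
  then obtain u' where u': "u = i # u'" by (cases u) auto
  have "i \<le> n" using u u' set_stirling_perms_132[of u n] by auto
  then show "w \<in> ?A"
    using u u' insert_pair_in_stirling_perms_132_iff[OF assms \<open>i \<le> n\<close>, of u']
    by (auto simp: numeral_2_eq_2)
qed

section \<open>Weighted sums by first letter and their recurrences\<close>

lemma take_1_eq_iff: "take 1 w = [i] \<longleftrightarrow> (\<exists>u. w = i # u)"
  by (cases w) auto

lemma take_2_eq_iff: "take 2 w = [i, i] \<longleftrightarrow> (\<exists>u. w = i # i # u)"
  by (cases w; cases "tl w") (auto simp: numeral_2_eq_2)

definition g_first :: "'a::field \<Rightarrow> 'a \<Rightarrow> 'a \<Rightarrow> nat \<Rightarrow> nat \<Rightarrow> 'a" where
  "g_first p q r n i = (\<Sum>w\<in>{w \<in> stirling_perms_132 n. take 1 w = [i]}. weight p q r w)"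

text \<open>This and its analogue for \<open>g_start\<close> allow sums for order \<open>n\<close>
  to run up to \<open>Suc n\<close>, matching those for order \<open>Suc n\<close>.\<close>

lemma g_first_outside:
  assumes "i \<notin> {1..n}"
  shows "g_first p q r n i = 0"
proof -
  have "{w \<in> stirling_perms_132 n. take 1 w = [i]} = {}"
    using assms unfolding take_1_eq_iff by (fastforce dest: set_stirling_perms_132)
  then show ?thesis by (simp only: g_first_def sum.empty)
qed

lemma g_start_outside:
  assumes "i \<notin> {1..n}"
  shows "g_start p q r n i = 0"
proof -
  have "{w \<in> stirling_perms_132 n. take 2 w = [i, i]} = {}"
    using assms unfolding take_2_eq_iff by (fastforce dest: set_stirling_perms_132)
  then show ?thesis by (simp only: g_start_def sum.empty)
qed

lemma sum_weight_hd_less: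
  "(\<Sum>w\<in>{w \<in> stirling_perms_132 n. w \<noteq> [] \<and> hd w < i}. weight p q r w) =
     (\<Sum>f\<in>{1..<i}. g_first p q r n f)"
proof -
  let ?S = "{w \<in> stirling_perms_132 n. w \<noteq> [] \<and> hd w < i}"
  have "hd ` ?S \<subseteq> {1..<i}"
    by (auto dest!: set_stirling_perms_132 hd_in_set)
  then have "(\<Sum>w\<in>?S. weight p q r w) =
      (\<Sum>f\<in>{1..<i}. \<Sum>w\<in>{w \<in> ?S. hd w = f}. weight p q r w)"
    by (intro sum.group[symmetric]) (auto simp: finite_stirling_perms_132)
  also have "\<dots> = (\<Sum>f\<in>{1..<i}. g_first p q r n f)"
  proof (rule sum.cong)
    fix f assume "f \<in> {1..<i}"
    then have "{w \<in> ?S. hd w = f} = {w \<in> stirling_perms_132 n. take 1 w = [f]}"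
      unfolding take_1_eq_iff by (auto simp: neq_Nil_conv)
    then show "(\<Sum>w\<in>{w \<in> ?S. hd w = f}. weight p q r w) = g_first p q r n f"
      by (simp only: g_first_def)
  qed simp
  finally show ?thesis .
qed

text \<open>For \<open>n \<ge> 1\<close> every permutation is nonempty with first letter below
  \<open>Suc n\<close>, so the sum by bounded first letter covers all of them.\<close>

lemma g_eq_sum_g_first:
  assumes "n \<ge> 1"
  shows "g p q r n = (\<Sum>i=1..n. g_first p q r n i)"
proof -
  have "w \<noteq> [] \<and> hd w < Suc n" if "w \<in> stirling_perms_132 n" for w
    using set_stirling_perms_132[OF that] assms hd_in_set[of w] by (cases "w = []") auto
  then have "{w \<in> stirling_perms_132 n. w \<noteq> [] \<and> hd w < Suc n} = stirling_perms_132 n"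
    by blast
  then show ?thesis using sum_weight_hd_less[where i = "Suc n" and n = n]
    by (simp add: g_def atLeastLessThanSuc_atLeastAtMost)
qed

text \<open>The new plateau contributes \<open>p\<close>. Behind it comes nothing if
  \<open>u\<close> is empty, a descent if \<open>u\<close> starts below \<open>i\<close>, and an
  ascent if \<open>u\<close> starts with \<open>i\<close>, which is relabelled to
  \<open>Suc i\<close>.\<close>

lemma g_start_Suc:
  assumes "1 \<le> i" "i \<le> Suc n"
  shows "g_start p q r (Suc n) i =
    (if n = 0 then p else 0) + p * r * g_start p q r n i +
    p * q * (\<Sum>f\<in>{1..<i}. g_first p q r n f)"
proof -
  let ?f = "\<lambda>u. i # i # map (skip i) u"
  let ?S0 = "{u \<in> stirling_perms_132 n. u = []}"
  let ?S1 = "{u \<in> stirling_perms_132 n. u \<noteq> [] \<and> hd u < i}"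
  let ?S2 = "{u \<in> stirling_perms_132 n. take 2 u = [i, i]}"
  have inj: "inj ?f" using inj_skip[of i] by (auto simp: inj_def)
  have fin: "finite ?S0" "finite ?S1" "finite ?S2" by (simp_all add: finite_stirling_perms_132)
  have "g_start p q r (Suc n) i = (\<Sum>u\<in>?S0 \<union> ?S1 \<union> ?S2. weight p q r (?f u))"
  proof -
    have "{u \<in> stirling_perms_132 n. u = [] \<or> u \<noteq> [] \<and> hd u < i \<or> take 2 u = [i, i]} =
        ?S0 \<union> ?S1 \<union> ?S2" by blast
    then show ?thesis
      unfolding g_start_def stirling_perms_132_start_pair[OF assms]
      by (simp add: sum.reindex[OF inj_on_subset[OF inj subset_UNIV]])
  qed
  also have "\<dots> = (\<Sum>u\<in>?S0. weight p q r (?f u)) + (\<Sum>u\<in>?S1. weight p q r (?f u)) +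
      (\<Sum>u\<in>?S2. weight p q r (?f u))"
  proof -
    have "(?S0 \<union> ?S1) \<inter> ?S2 = {}" by (auto simp: take_Suc numeral_2_eq_2)
    moreover have "?S0 \<inter> ?S1 = {}" by auto
    ultimately show ?thesis using fin by (simp only: sum.union_disjoint finite_UnI)
  qed
  also have "(\<Sum>u\<in>?S0. weight p q r (?f u)) = (if n = 0 then p else 0)"
  proof (cases "n = 0")
    case True
    then have "?S0 = {[]}" by (auto simp: stirling_perms_132_0)
    then show ?thesis using True by (simp add: weight_Cons_Cons)
  next
    case False
    then have "?S0 = {}" by (auto dest: set_stirling_perms_132)
    then show ?thesis using False by (simp only: sum.empty if_False)
  qed
  also have "(\<Sum>u\<in>?S1. weight p q r (?f u)) = p * q * (\<Sum>u\<in>?S1. weight p q r u)"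
    unfolding sum_distrib_left
  proof (rule sum.cong)
    fix u assume "u \<in> ?S1"
    then obtain f w where u: "u = f # w" "f < i" by (cases u) auto
    then have "skip i f = f" by (simp add: skip_def)
    then show "weight p q r (?f u) = p * q * weight p q r u"
      using u weight_map[OF strict_mono_skip[of i], of p q r u] by (simp add: weight_Cons_Cons)
  qed simp
  also have "(\<Sum>u\<in>?S2. weight p q r (?f u)) = p * r * (\<Sum>u\<in>?S2. weight p q r u)"
    unfolding sum_distrib_left
  proof (rule sum.cong)
    fix u assume "u \<in> ?S2"
    then obtain w where u: "u = i # w" by (cases u) (auto simp: numeral_2_eq_2)
    have "skip i i = Suc i" by (simp add: skip_def)
    then show "weight p q r (?f u) = p * r * weight p q r u"
      using u weight_map[OF strict_mono_skip[of i], of p q r u] by (simp add: weight_Cons_Cons)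
  qed simp
  finally show ?thesis
    unfolding sum_weight_hd_less g_start_def by (simp add: algebra_simps)
qed

text \<open>Inserting the pair behind \<open>i\<close> costs \<open>p * r\<close> if the next letter
  of \<open>u\<close> is larger. If \<open>u\<close> starts with \<open>i, i\<close>, its plateau is
  lost and an ascent, a plateau and a descent appear, a net factor \<open>r * q\<close>. The last
  summand corrects for this difference.\<close>

lemma g_first_Suc:
  assumes "1 \<le> i"
  shows "g_first p q r (Suc n) i =
    g_start p q r (Suc n) i + p * r * g_first p q r n i + r * (q - p) * g_start p q r n i"
proof -
  let ?f = "\<lambda>u. i # Suc i # Suc i # map (skip (Suc i)) (tl u)"
  let ?S = "\<lambda>n. {u \<in> stirling_perms_132 n. take 1 u = [i]}"
  let ?S2 = "\<lambda>n. {u \<in> stirling_perms_132 n. take 2 u = [i, i]}"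
  have S2: "?S2 m \<subseteq> ?S m" for m unfolding take_1_eq_iff take_2_eq_iff by blast
  have split: "(\<Sum>u\<in>?S m. h u) = (\<Sum>u\<in>?S m - ?S2 m. h u) + (\<Sum>u\<in>?S2 m. h u)"
    for m and h :: "nat list \<Rightarrow> 'a"
    by (rule sum.subset_diff[OF S2]) (simp add: finite_stirling_perms_132)
  have S: "?S (Suc n) - ?S2 (Suc n) = ?f ` ?S n"
    using stirling_perms_132_start_no_pair[OF assms, of n] by auto
  have inj: "inj_on ?f (?S n)"
  proof (rule inj_onI)
    fix u v assume "u \<in> ?S n" "v \<in> ?S n" "?f u = ?f v"
    moreover from this have "tl u = tl v" using inj_skip[of "Suc i"] by (simp add: inj_map_eq_map)
    \<comment> \<open>Both words start with \<open>i\<close>, so the tails determine them.\<close>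
    ultimately show "u = v" by (cases u; cases v) auto
  qed
  have step: "weight p q r (?f u) = p * r * weight p q r u" if mem: "u \<in> ?S n - ?S2 n" for u
  proof -
    obtain w1 where w1: "u = i # w1" using mem unfolding take_1_eq_iff by blast
    have perm: "mset (i # w1) = doubled n" "stirling_word (i # w1)"
      using mem w1 by (auto simp: stirling_perms_132_iff)
    have "i \<in> set w1" using perm(1) by (rule mset_Cons_eq_doubled_imp_mem)
    then obtain y w2 where w2: "w1 = y # w2" by (cases w1) auto
    have "y \<noteq> i" using mem w1 w2 by (auto simp: numeral_2_eq_2)
    then have "occurs_before y i w1" using \<open>i \<in> set w1\<close> w2 by auto
    then have "i < y" using perm(2) by (auto simp: stirling_word_Cons)
    \<comment> \<open>Relabelling lifts \<open>y\<close> strictly above the inserted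
      \<open>Suc i\<close>, even when \<open>y = Suc i\<close>; an ascent follows the new
      plateau.\<close>
    then have "skip (Suc i) y = Suc y" by (simp add: skip_def)
    then show ?thesis
      using w1 w2 \<open>i < y\<close> weight_map[OF strict_mono_skip[of "Suc i"], of p q r w1]
      by (simp add: weight_Cons_Cons)
  qed
  have step2: "weight p q r (?f u) = r * q * weight p q r u" if mem: "u \<in> ?S2 n" for u
  proof -
    obtain w where u: "u = i # i # w" using mem unfolding take_2_eq_iff by blast
    have "skip (Suc i) i = i" by (simp add: skip_def)
    then show ?thesis
      using u weight_map[OF strict_mono_skip[of "Suc i"], of p q r "i # w"]
      by (simp add: weight_Cons_Cons)
  qed
  have "g_first p q r (Suc n) i =
      (\<Sum>u\<in>?S n. weight p q r (?f u)) + g_start p q r (Suc n) i"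
    unfolding g_first_def g_start_def split[of _ "Suc n"] S sum.reindex[OF inj]
    by (simp only: o_def)
  also have "(\<Sum>u\<in>?S n. weight p q r (?f u)) =
      (\<Sum>u\<in>?S n - ?S2 n. p * r * weight p q r u) + (\<Sum>u\<in>?S2 n. r * q * weight p q r u)"
    unfolding split[of _ n]
    by (intro arg_cong2[where f = "(+)"] sum.cong refl) (simp_all only: step step2)
  also have "\<dots> = p * r * (g_first p q r n i - g_start p q r n i) + r * q * g_start p q r n i"
    unfolding g_first_def g_start_def split[of _ n] by (simp add: sum_distrib_left)
  finally show ?thesis by (simp add: algebra_simps)
qed

section \<open>Generating functions and the elimination of \<open>D_132\<close>\<close>

definition D_coeff :: "'a::field \<Rightarrow> 'a \<Rightarrow> 'a \<Rightarrow> 'a \<Rightarrow> nat \<Rightarrow> 'a" where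
  "D_coeff p q r v n = (\<Sum>i=1..n. g_first p q r n i * v ^ (i - 1))"

definition D_132 :: "'a::field \<Rightarrow> 'a \<Rightarrow> 'a \<Rightarrow> 'a \<Rightarrow> 'a fps" where
  "D_132 p q r v = Abs_fps (D_coeff p q r v)"

lemma L_132_eq: "L_132 p q r v = Abs_fps (L_coeff p q r v)"
  by (rule fps_ext) (simp add: L_132_def L_coeff_def)

lemma D_coeff_Suc:
  "D_coeff p q r v (Suc n) = L_coeff p q r v (Suc n) + p * r * D_coeff p q r v n +
     r * (q - p) * L_coeff p q r v n"
proof -
  have D: "D_coeff p q r v n = (\<Sum>i=1..Suc n. g_first p q r n i * v ^ (i - 1))"
    by (simp add: D_coeff_def g_first_outside)
  have L: "L_coeff p q r v n = (\<Sum>i=1..Suc n. g_start p q r n i * v ^ (i - 1))"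
    by (simp add: L_coeff_def g_start_outside)
  show ?thesis
    unfolding D L unfolding D_coeff_def L_coeff_def sum_distrib_left sum.distrib[symmetric]
    by (rule sum.cong) (auto simp: g_first_Suc algebra_simps)
qed

text \<open>Exchanging the sums over \<open>f < i\<close> gives, for each \<open>f\<close>, a
  geometric sum in \<open>v\<close>. Its lower end produces \<open>D_coeff\<close> at
  \<open>v\<close>; its upper end does not depend on \<open>f\<close> and produces
  \<open>D_coeff\<close> at 1. The factor \<open>1 - v\<close> stays on the left, so
  \<open>v = 1\<close> is covered as well.\<close>

lemma L_coeff_Suc:
  "(1 - v) * (L_coeff p q r v (Suc n) - p * r * L_coeff p q r v n) =
     (1 - v) * (if n = 0 then p else 0) +
     p * q * v * (D_coeff p q r v n - v ^ n * D_coeff p q r 1 n)"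
proof -
  have L: "L_coeff p q r v n = (\<Sum>i=1..Suc n. g_start p q r n i * v ^ (i - 1))"
    by (simp add: L_coeff_def g_start_outside)
  \<comment> \<open>One factor \<open>v\<close> is pulled out so that the exponent
    \<open>f - 1\<close> of \<open>D_coeff\<close> appears.\<close>
  have geom: "(1 - v) * (\<Sum>i=Suc f..Suc n. v ^ (i - 1)) = v * (v ^ (f - 1) - v ^ n)"
    if "f \<in> {1..n}" for f
  proof -
    have "(\<Sum>i=Suc f..Suc n. v ^ (i - 1)) = (\<Sum>i=f..n. v ^ i)"
      by (subst sum.shift_bounds_cl_Suc_ivl) simp
    then show ?thesis using that sum_gp_multiplied[of f n v]
      by (cases f) (auto simp: algebra_simps)
  qed
  have "(\<Sum>i=1..Suc n. (\<Sum>f\<in>{1..<i}. g_first p q r n f) * v ^ (i - 1)) =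
      (\<Sum>i=1..Suc n. \<Sum>f\<in>{f \<in> {1..n}. f < i}. g_first p q r n f * v ^ (i - 1))"
    unfolding sum_distrib_right by (intro sum.cong) auto
  also have "\<dots> = (\<Sum>f=1..n. \<Sum>i\<in>{i \<in> {1..Suc n}. f < i}. g_first p q r n f * v ^ (i - 1))"
    by (rule sum.swap_restrict) simp_all
  also have "\<dots> = (\<Sum>f=1..n. g_first p q r n f * (\<Sum>i=Suc f..Suc n. v ^ (i - 1)))"
    unfolding sum_distrib_left by (intro sum.cong) auto
  finally have "(1 - v) * (\<Sum>i=1..Suc n. (\<Sum>f\<in>{1..<i}. g_first p q r n f) * v ^ (i - 1)) =
      (\<Sum>f=1..n. g_first p q r n f * ((1 - v) * (\<Sum>i=Suc f..Suc n. v ^ (i - 1))))"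
    by (simp add: sum_distrib_left mult_ac del: sum.cl_ivl_Suc)
  also have "\<dots> = (\<Sum>f=1..n. g_first p q r n f * (v * (v ^ (f - 1) - v ^ n)))"
    by (intro sum.cong) (simp_all only: geom)
  also have "\<dots> = v * (D_coeff p q r v n - v ^ n * D_coeff p q r 1 n)"
    by (simp add: D_coeff_def sum_distrib_left sum_subtractf algebra_simps)
  finally have D: "(1 - v) * (\<Sum>i=1..Suc n. (\<Sum>f\<in>{1..<i}. g_first p q r n f) * v ^ (i - 1)) =
      v * (D_coeff p q r v n - v ^ n * D_coeff p q r 1 n)" .
  \<comment> \<open>For \<open>n = 0\<close> the only index is 1, where the exponent of
    \<open>v\<close> is 0.\<close>
  have const: "(\<Sum>i=1..Suc n. (if n = 0 then p else 0) * v ^ (i - 1)) = (if n = 0 then p else 0)"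
    by simp
  have "L_coeff p q r v (Suc n) =
      (\<Sum>i=1..Suc n. (if n = 0 then p else 0) * v ^ (i - 1)) +
      p * r * (\<Sum>i=1..Suc n. g_start p q r n i * v ^ (i - 1)) +
      p * q * (\<Sum>i=1..Suc n. (\<Sum>f\<in>{1..<i}. g_first p q r n f) * v ^ (i - 1))"
    unfolding L_coeff_def sum_distrib_left[of "p * _"] sum.distrib[symmetric]
    by (rule sum.cong) (auto simp: g_start_Suc algebra_simps)
  then have "L_coeff p q r v (Suc n) - p * r * L_coeff p q r v n = (if n = 0 then p else 0) +
      p * q * (\<Sum>i=1..Suc n. (\<Sum>f\<in>{1..<i}. g_first p q r n f) * v ^ (i - 1))"
    unfolding const L by (simp del: sum.cl_ivl_Suc)
  then have "(1 - v) * (L_coeff p q r v (Suc n) - p * r * L_coeff p q r v n) =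
      (1 - v) * (if n = 0 then p else 0) +
      p * q * ((1 - v) * (\<Sum>i=1..Suc n. (\<Sum>f\<in>{1..<i}. g_first p q r n f) * v ^ (i - 1)))"
    by (simp only: distrib_left mult_ac)
  then show ?thesis unfolding D by (simp only: mult_ac)
qed

lemma D_132_L_132:
  "(1 - fps_const (p * r) * fps_X) * D_132 p q r v =
     (1 + fps_const (r * (q - p)) * fps_X) * L_132 p q r v"
proof (rule fps_ext)
  show "fps_nth ((1 - fps_const (p * r) * fps_X) * D_132 p q r v) n =
      fps_nth ((1 + fps_const (r * (q - p)) * fps_X) * L_132 p q r v) n" for n
  proof (cases n)
    case 0
    then show ?thesis by (simp add: D_132_def L_132_eq D_coeff_def L_coeff_def)
  next
    case (Suc m)
    then show ?thesis using D_coeff_Suc[of p q r v m]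
      by (simp add: D_132_def L_132_eq ring_distribs mult.assoc)
  qed
qed

text \<open>Substituting \<open>vx\<close> for \<open>x\<close> multiplies the coefficient of order
  \<open>n\<close> by \<open>v ^ n\<close>, which accounts for the subtracted term of
  \<open>L_coeff_Suc\<close>.\<close>

lemma L_132_functional_equation:
  "fps_const (1 - v) * ((1 - fps_const (p * r) * fps_X) * L_132 p q r v) =
     fps_const (1 - v) * (fps_const p * fps_X) +
     fps_const (p * q * v) * fps_X *
       (D_132 p q r v - fps_compose (D_132 p q r 1) (fps_const v * fps_X))"
proof (rule fps_ext)
  show "fps_nth (fps_const (1 - v) * ((1 - fps_const (p * r) * fps_X) * L_132 p q r v)) n =
     fps_nth (fps_const (1 - v) * (fps_const p * fps_X) + fps_const (p * q * v) * fps_X *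
       (D_132 p q r v - fps_compose (D_132 p q r 1) (fps_const v * fps_X))) n" for n
  proof (cases n)
    case 0
    then show ?thesis by (simp add: L_132_eq L_coeff_def)
  next
    case (Suc m)
    then show ?thesis using L_coeff_Suc[of v p q r m]
      by (simp add: D_132_def L_132_eq fps_compose_linear left_diff_distrib mult.assoc)
  qed
qed

text \<open>The empty word has no first letter and supplies the summand 1.\<close>

lemma C_132_eq: "C_132 p q r = 1 + D_132 p q r 1"
proof (rule fps_ext)
  show "fps_nth (C_132 p q r) n = fps_nth (1 + D_132 p q r 1) n" for n
    using g_eq_sum_g_first[of n p q r]
    by (cases n) (auto simp: C_132_def D_132_def D_coeff_def g_def stirling_perms_132_0)
qed

theorem theorem2p10:
  fixes p q r :: "'a::field"
  shows
    "C_132 p q r =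
       1 + (1 + fps_const (r * (q - p)) * fps_X) / (1 - fps_const (p * r) * fps_X) * L_132 p q r 1
     \<and>
     (\<forall>v::'a. v \<noteq> 1 \<longrightarrow>
       ((1 - fps_const (p * r) * fps_X) ^ 2
          - fps_const (p * q * v) * fps_X * (1 + fps_const (r * (q - p)) * fps_X)
              / fps_const (1 - v)) * L_132 p q r v
       = fps_const p * fps_X * (1 - fps_const (p * r) * fps_X)
         - fps_const (p * q * v) * fps_X * (1 - fps_const (p * r) * fps_X)
              * (1 + fps_const ((q - p) * r * v) * fps_X)
              / ((1 - fps_const (p * r * v) * fps_X) * fps_const (1 - v))
              * fps_compose (L_132 p q r 1) (fps_const v * fps_X))"
proof (intro conjI allI impI)
  define A B where "A = 1 - fps_const (p * r) * fps_X"
    and "B = 1 + fps_const (r * (q - p)) * fps_X"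
  \<comment> \<open>\<open>A\<close> has constant term 1, so it is a unit and division by it is
    multiplication by its inverse.\<close>
  have inv_A: "A * inverse A = 1"
    by (subst mult.commute, rule inverse_mult_eq_1) (simp add: A_def)
  have div_A: "F / A = F * inverse A" for F
    by (rule fps_divide_unit) (simp add: A_def)
  have AD: "A * D_132 p q r v = B * L_132 p q r v" for v
    unfolding A_def B_def by (rule D_132_L_132)
  have "D_132 p q r 1 = A * inverse A * D_132 p q r 1" by (simp add: inv_A)
  also have "\<dots> = inverse A * (B * L_132 p q r 1)" by (simp flip: AD)
  finally show "C_132 p q r = 1 + B / A * L_132 p q r 1"
    by (simp add: C_132_eq div_A mult_ac)

  fix v :: 'a assume "v \<noteq> 1"
  define V where "V = fps_const (1 - v)"
  define A' B' where "A' = 1 - fps_const (p * r * v) * fps_X"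
    and "B' = 1 + fps_const ((q - p) * r * v) * fps_X"
  define L' D' where "L' = fps_compose (L_132 p q r 1) (fps_const v * fps_X)"
    and "D' = fps_compose (D_132 p q r 1) (fps_const v * fps_X)"
  have inv_A': "A' * inverse A' = 1"
    by (subst mult.commute, rule inverse_mult_eq_1) (simp add: A'_def)
  \<comment> \<open>This is where \<open>v \<noteq> 1\<close> enters: the constant
    \<open>1 - v\<close> must be a unit.\<close>
  have inv_V: "V * inverse V = 1"
    by (subst mult.commute, rule inverse_mult_eq_1) (use \<open>v \<noteq> 1\<close> in \<open>simp add: V_def\<close>)
  have div_V: "F / V = F * inverse V" for F
    by (rule fps_divide_unit) (use \<open>v \<noteq> 1\<close> in \<open>simp add: V_def\<close>)
  have div_A'V: "F / (A' * V) = F * inverse A' * inverse V" for F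
    by (subst fps_divide_unit)
      (use \<open>v \<noteq> 1\<close> in \<open>simp_all add: A'_def V_def fps_inverse_mult mult.assoc\<close>)
  \<comment> \<open>This is the relation between \<open>D_132\<close> and \<open>L_132\<close> at
    parameter 1, with \<open>vx\<close> substituted for \<open>x\<close>.\<close>
  have "A' * D' = B' * L'"
  proof -
    have "fps_compose A (fps_const v * fps_X) = A'" "fps_compose B (fps_const v * fps_X) = B'"
      by (simp_all add: A_def A'_def B_def B'_def fps_compose_sub_distrib fps_compose_add_distrib
        fps_compose_mult_distrib mult_ac flip: fps_const_mult)
    then show ?thesis
      using arg_cong[OF AD[of 1], of "\<lambda>F. fps_compose F (fps_const v * fps_X)"]
      by (simp add: fps_compose_mult_distrib L'_def D'_def)
  qed
  then have D': "D' = B' * inverse A' * L'"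
    using inv_A' by algebra
  define K where "K = fps_const (p * q * v) * fps_X"
  define P where "P = fps_const p * fps_X"
  have "V * (A * L_132 p q r v) = V * P + K * (D_132 p q r v - D')"
    unfolding V_def A_def P_def K_def D'_def by (rule L_132_functional_equation)
  \<comment> \<open>Multiply by \<open>A\<close> to trade \<open>A * D_132 p q r v\<close> for
    \<open>B * L_132 p q r v\<close>, insert \<open>D'\<close>, and cancel \<open>V\<close>.\<close>
  then have "(A ^ 2 - K * B * inverse V) * L_132 p q r v =
      P * A - K * A * B' * inverse A' * inverse V * L'"
    using AD[of v] inv_V D' by algebra
  then show "(A ^ 2 - K * B / V) * L_132 p q r v = P * A - K * A * B' / (A' * V) * L'"
    unfolding div_V div_A'V .
qed

end
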